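(* Let $A=\{1,\dots,n\}$, and let $c:2^A\to\mathbb{R}_{\ge 0}$ and $f:2^A\to[0,1]$ be functions describing the cost and the reward of a given set of actions, such that the number $|\mathcal{C}_{f,c}|$ of critical values is polynomial in $|A|=n$. Assume further that there exists an efficient algorithm to compute the agent's demand, i.e. an algorithm that, given a contract $\alpha\in[0,1]$, returns the best response $S_\alpha$ in time polynomial in $n$. Then the optimal contract can be computed efficiently, i.e. in time polynomial in $n$.
   Context: Contract setting: $A=\{1,\dots,n\}$ is a set of actions, $f:2^A\to[0,1]$ is the reward (success probability) function and $c:2^A\to\mathbb{R}_{\ge0}$ is the cost function. A contract is a number $\alpha\in[0,1]$. For $S\subseteq A$, the agent's utility is $u_a(\alpha,S)=\alpha f(S)-c(S)$ and the principal's utility is $u_p(\alpha,S)=(1-\alpha)f(S)$. The agent's best response (demand) $S_\alpha$ is a set maximizing $u_a(\alpha,\cdot)$ over all $S\subseteq A$; ties are broken in favor of sets with larger $f$, and remaining ties are broken by a consistent rule independent of $\alpha$ (e.g. a fixed total order on the subsets of $A$). An optimal contract is an $\alpha\in[0,1]$ maximizing $u_p(\alpha)=(1-\alpha)f(S_\alpha)$. Critical values are the values of $\alpha\in[0,1]$ at which the agent's demand changes: $\alpha=0$ is counted as critical by convention, and $\alpha\in(0,1]$ is critical if for every $\varepsilon>0$ there is $x\in[0,1]$ with $\alpha-\varepsilon<x<\alpha$ and $S_x\neq S_\alpha$. The (finite) set of critical values is denoted $\mathcal{C}_{f,c}$. Access model: $f$ and $c$ are given by value oracles (given $S$, return $f(S)$,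 resp. $c(S)$). Running time is measured with arithmetic operations, comparisons and value-oracle calls counted as unit-cost steps. "Polynomial in $n$" is understood uniformly over the class of instances $(f,c)$ considered. *)

theory Defs
  imports Complex_Main "HOL-Computational_Algebra.Polynomial"
begin

section \<open>Contracts with combinatorial actions\<close>

text \<open>The field \<open>tie\<close> is the order that resolves those ties in the agent's best
  response which are left after preferring larger rewards; the least set is chosen. It does not
  depend on the contract.\<close>

record setting =
  size_of :: nat
  reward :: "nat set \<Rightarrow> real"
  cost :: "nat set \<Rightarrow> real"
  tie :: "nat set rel"

definition actions :: "setting \<Rightarrow> nat set" where
  "actions J = {1..size_of J}"

definition valid_setting :: "setting \<Rightarrow> bool" where
  "valid_setting J \<longleftrightarrow>
     (\<forall>S \<subseteq> actions J. 0 \<le> reward J S \<and> reward J S \<le> 1) \<and>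
     (\<forall>S \<subseteq> actions J. 0 \<le> cost J S) \<and>
     linear_order_on (Pow (actions J)) (tie J)"

definition agent_utility :: "setting \<Rightarrow> real \<Rightarrow> nat set \<Rightarrow> real" where
  "agent_utility J \<alpha> S = \<alpha> * reward J S - cost J S"

definition principal_utility :: "setting \<Rightarrow> real \<Rightarrow> nat set \<Rightarrow> real" where
  "principal_utility J \<alpha> S = (1 - \<alpha>) * reward J S"

definition best_responses :: "setting \<Rightarrow> real \<Rightarrow> nat set set" where
  "best_responses J \<alpha> =
     {S. S \<subseteq> actions J \<and> (\<forall>T \<subseteq> actions J. agent_utility J \<alpha> T \<le> agent_utility J \<alpha> S)}"

definition favored_responses :: "setting \<Rightarrow> real \<Rightarrow> nat set set" where
  "favored_responses J \<alpha> =
     {S \<in> best_responses J \<alpha>. \<forall>T \<in> best_responses J \<alpha>. reward J T \<le> reward J S}"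

definition demand :: "setting \<Rightarrow> real \<Rightarrow> nat set" where
  "demand J \<alpha> =
     (THE S. S \<in> favored_responses J \<alpha> \<and> (\<forall>T \<in> favored_responses J \<alpha>. (S, T) \<in> tie J))"

definition optimal_contract :: "setting \<Rightarrow> real \<Rightarrow> bool" where
  "optimal_contract J \<alpha> \<longleftrightarrow> \<alpha> \<in> {0..1} \<and>
     (\<forall>\<beta> \<in> {0..1}. principal_utility J \<beta> (demand J \<beta>) \<le> principal_utility J \<alpha> (demand J \<alpha>))"

definition critical_values :: "setting \<Rightarrow> real set" where
  "critical_values J = {\<alpha> \<in> {0..1}. \<alpha> = 0 \<or>
     (\<forall>\<epsilon>>0. \<exists>x \<in> {0..1}. \<alpha> - \<epsilon> < x \<and> x < \<alpha> \<and> demand J x \<noteq> demand J \<alpha>)}"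

text \<open>The definite description in \<^const>\<open>demand\<close> always denotes, and there are only finitely
  many critical values, so that \<^const>\<open>card\<close> counts them.\<close>

lemma ex1_demand:
  assumes "valid_setting J"
  shows "\<exists>!S. S \<in> favored_responses J \<alpha> \<and> (\<forall>T \<in> favored_responses J \<alpha>. (S, T) \<in> tie J)"
proof -
  let ?P = "Pow (actions J)" and ?B = "best_responses J \<alpha>" and ?F = "favored_responses J \<alpha>"
  have fin: "finite ?P" by (simp add: actions_def)
  have BP: "?B \<subseteq> ?P" and FB: "?F \<subseteq> ?B"
    by (auto simp: best_responses_def favored_responses_def)
  have finB: "finite ?B" and finF: "finite ?F"
    using fin BP FB by (meson finite_subset)+
  have "?B \<noteq> {}"
  proof -
    have ne: "agent_utility J \<alpha> ` ?P \<noteq> {}" by auto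
    obtain S where "S \<in> ?P" "agent_utility J \<alpha> S = Max (agent_utility J \<alpha> ` ?P)"
      using Max_in[OF finite_imageI[OF fin] ne] by (metis imageE)
    then have "S \<in> ?B" using fin by (auto simp: best_responses_def)
    then show ?thesis by auto
  qed
  then obtain S where "S \<in> ?B" "reward J S = Max (reward J ` ?B)"
    using Max_in[OF finite_imageI[OF finB], of "reward J"] by (metis imageE image_is_empty)
  then have "S \<in> ?F" using finB by (auto simp: favored_responses_def)
  then have neF: "?F \<noteq> {}" by auto
  have lin: "linear_order_on ?P (tie J)" using assms by (simp add: valid_setting_def)
  have rf: "(S, S) \<in> tie J" if "S \<in> ?P" for S
    using lin that by (auto simp: order_on_defs refl_on_def)
  have total: "(S, T) \<in> tie J \<or> (T, S) \<in> tie J" if "S \<in> ?P" "T \<in> ?P" for S T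
    using lin that rf by (cases "S = T") (auto simp: order_on_defs total_on_def)
  have tr: "(S, U) \<in> tie J" if "(S, T) \<in> tie J" "(T, U) \<in> tie J" for S T U
    using lin that by (auto simp: order_on_defs dest: transD)
  have anti: "S = T" if "(S, T) \<in> tie J" "(T, S) \<in> tie J" for S T
    using lin that by (auto simp: order_on_defs dest: antisymD)
  have least: "\<exists>S\<in>M. \<forall>T\<in>M. (S, T) \<in> tie J" if "finite M" "M \<noteq> {}" "M \<subseteq> ?P" for M
    using that
  proof (induction rule: finite_ne_induct)
    case (singleton S)
    then show ?case using rf by simp
  next
    case (insert S M)
    then obtain T where T: "T \<in> M" "\<forall>U\<in>M. (T, U) \<in> tie J" by auto
    show ?case
    proof (cases "(T, S) \<in> tie J")
      case True
      then show ?thesis using T by auto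
    next
      case False
      then have "(S, T) \<in> tie J" using total insert.prems T by blast
      then have "\<forall>U\<in>insert S M. (S, U) \<in> tie J" using T tr rf insert.prems by blast
      then show ?thesis by blast
    qed
  qed
  obtain S where "S \<in> ?F" "\<forall>T\<in>?F. (S, T) \<in> tie J"
    using least[OF finF neF] FB BP by auto
  then show ?thesis using anti by blast
qed

lemma demand_favored: "valid_setting J \<Longrightarrow> demand J \<alpha> \<in> favored_responses J \<alpha>"
  using theI'[OF ex1_demand, of J \<alpha>] by (simp add: demand_def)

lemma demand_cong: "favored_responses J \<alpha> = favored_responses J \<beta> \<Longrightarrow> demand J \<alpha> = demand J \<beta>"
  by (simp add: demand_def)

lemma demand_between:
  assumes J: "valid_setting J" and x: "\<alpha> < x" "x < \<beta>" and eq: "demand J \<alpha> = demand J \<beta>"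
  shows "demand J x = demand J \<beta>"
proof -
  define S where "S = demand J \<beta>"
  have "S \<in> favored_responses J \<alpha>" "S \<in> favored_responses J \<beta>"
    using demand_favored[OF J] by (metis eq S_def)+
  then have SA: "S \<subseteq> actions J"
    and a: "\<And>T. T \<subseteq> actions J \<Longrightarrow> agent_utility J \<alpha> T \<le> agent_utility J \<alpha> S"
    and b: "\<And>T. T \<subseteq> actions J \<Longrightarrow> agent_utility J \<beta> T \<le> agent_utility J \<beta> S"
    and m: "\<And>T. T \<in> best_responses J \<beta> \<Longrightarrow> reward J T \<le> reward J S"
    by (auto simp: favored_responses_def best_responses_def)
  define l where "l = (x - \<alpha>) / (\<beta> - \<alpha>)"
  have l: "0 < l" "l < 1" using x by (auto simp: l_def)
  have "l * (\<beta> - \<alpha>) = x - \<alpha>" using x by (simp add: l_def)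
  then have x_eq: "x = (1 - l) * \<alpha> + l * \<beta>" by (simp add: algebra_simps)
  have ux: "agent_utility J x T = (1 - l) * agent_utility J \<alpha> T + l * agent_utility J \<beta> T" for T
    by (simp add: agent_utility_def x_eq algebra_simps)
  have le: "agent_utility J x T \<le> agent_utility J x S" if "T \<subseteq> actions J" for T
    unfolding ux using a[OF that] b[OF that] l by (intro add_mono mult_left_mono) auto
  have same: "reward J T = reward J S \<and> cost J T = cost J S"
    if T: "T \<subseteq> actions J" and e: "agent_utility J x T = agent_utility J x S" for T
  proof -
    have "(1 - l) * (agent_utility J \<alpha> S - agent_utility J \<alpha> T)
        + l * (agent_utility J \<beta> S - agent_utility J \<beta> T) = 0"
      using e unfolding ux by (simp add: algebra_simps)
    moreover have "0 \<le> (1 - l) * (agent_utility J \<alpha> S - agent_utility J \<alpha> T)"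
      "0 \<le> l * (agent_utility J \<beta> S - agent_utility J \<beta> T)"
      using a[OF T] b[OF T] l by auto
    ultimately have "(1 - l) * (agent_utility J \<alpha> S - agent_utility J \<alpha> T) = 0"
      "l * (agent_utility J \<beta> S - agent_utility J \<beta> T) = 0" by linarith+
    then have e1: "agent_utility J \<alpha> S = agent_utility J \<alpha> T"
      and e2: "agent_utility J \<beta> S = agent_utility J \<beta> T" using l by auto
    then have "(\<beta> - \<alpha>) * (reward J S - reward J T) = 0"
      by (simp add: agent_utility_def algebra_simps)
    then have "reward J S = reward J T" using x by auto
    then show ?thesis using e1 by (simp add: agent_utility_def)
  qed
  let ?L = "{T. T \<subseteq> actions J \<and> reward J T = reward J S \<and> cost J T = cost J S}"
  have "best_responses J x = ?L"
  proof (intro set_eqI iffI)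
    fix T assume "T \<in> best_responses J x"
    then have T: "T \<subseteq> actions J" and "agent_utility J x S \<le> agent_utility J x T"
      using SA by (auto simp: best_responses_def)
    then have "agent_utility J x T = agent_utility J x S" using le[OF T] by simp
    then show "T \<in> ?L" using T same by simp
  next
    fix T assume "T \<in> ?L"
    then show "T \<in> best_responses J x"
      using le by (simp add: best_responses_def agent_utility_def)
  qed
  then have "favored_responses J x = ?L" by (auto simp: favored_responses_def)
  moreover have "favored_responses J \<beta> = ?L"
  proof -
    have SB: "S \<in> best_responses J \<beta>" using SA b by (auto simp: best_responses_def)
    have "?L \<subseteq> favored_responses J \<beta>"
      using b m by (auto simp: favored_responses_def best_responses_def agent_utility_def)
    moreover have "T \<in> ?L" if "T \<in> favored_responses J \<beta>" for T
    proof -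
      have T: "T \<subseteq> actions J" "reward J T = reward J S" "agent_utility J \<beta> T = agent_utility J \<beta> S"
        using that m SB b SA by (auto simp: favored_responses_def best_responses_def intro: antisym)
      then show ?thesis by (simp add: agent_utility_def)
    qed
    ultimately show ?thesis by blast
  qed
  ultimately show ?thesis using demand_cong by metis
qed

lemma finite_critical_values:
  assumes J: "valid_setting J"
  shows "finite (critical_values J)"
proof (rule inj_on_finite)
  have "demand J \<alpha> \<noteq> demand J \<beta>"
    if "\<alpha> \<in> critical_values J" "\<beta> \<in> critical_values J" "\<alpha> < \<beta>" for \<alpha> \<beta>
  proof
    assume eq: "demand J \<alpha> = demand J \<beta>"
    have "0 < \<beta> - \<alpha>" "\<beta> \<noteq> 0" using that by (auto simp: critical_values_def)
    then have "\<forall>\<epsilon>>0. \<exists>x\<in>{0..1}. \<beta> - \<epsilon> < x \<and> x < \<beta> \<and> demand J x \<noteq> demand J \<beta>"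
      using that(2) by (simp add: critical_values_def)
    from this[rule_format, OF \<open>0 < \<beta> - \<alpha>\<close>]
    obtain x where "\<beta> - (\<beta> - \<alpha>) < x" "x < \<beta>" "demand J x \<noteq> demand J \<beta>"
      by blast
    then show False using demand_between[OF J _ _ eq, of x] by auto
  qed
  then show "inj_on (demand J) (critical_values J)"
    by (metis inj_onI linorder_neqE)
  show "demand J ` critical_values J \<subseteq> Pow (actions J)"
  proof -
    have "demand J \<alpha> \<subseteq> actions J" for \<alpha>
      using demand_favored[OF J, of \<alpha>] by (simp add: favored_responses_def best_responses_def)
    then show ?thesis by blast
  qed
  show "finite (Pow (actions J))" by (simp add: actions_def)
qed


section \<open>Real random access machines with value oracles\<close>

text \<open>A store consists of an index memory of natural numbers and a memory of real numbers.
  A cell of either memory is addressed directly, or indirectly through an index cell. Index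
  arithmetic is restricted to addition and truncated subtraction, and there is no rounding of
  reals: either of multiplication on indices or rounding at unit cost would make the
  machine unreasonably powerful. Division by zero yields zero.\<close>

type_synonym store = "(nat \<Rightarrow> nat) \<times> (nat \<Rightarrow> real)"

datatype addr = Dir nat | Ind nat

fun loc :: "(nat \<Rightarrow> nat) \<Rightarrow> addr \<Rightarrow> nat" where
  "loc N (Dir k) = k"
| "loc N (Ind k) = N k"

datatype index_op = NAdd | NSub

datatype real_op = RAdd | RSub | RMul | RDiv

fun index_fun :: "index_op \<Rightarrow> nat \<Rightarrow> nat \<Rightarrow> nat" where
  "index_fun NAdd = (+)"
| "index_fun NSub = (-)"

fun real_fun :: "real_op \<Rightarrow> real \<Rightarrow> real \<Rightarrow> real" where
  "real_fun RAdd = (+)"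
| "real_fun RSub = (-)"
| "real_fun RMul = (*)"
| "real_fun RDiv = (/)"

datatype instr =
    NConst addr nat
  | NMove addr addr
  | NOp index_op addr addr addr
  | RConst addr int
  | RMove addr addr
  | ROp real_op addr addr addr
  | AskReward addr addr
  | AskCost addr addr

datatype test =
    NLess addr addr
  | NLeq addr addr
  | RLess addr addr
  | RLeq addr addr

text \<open>A set of actions is held in memory as a characteristic vector: action \<open>i\<close> belongs to
  the set at base address \<open>b\<close> iff cell \<open>b + i\<close> is nonzero.\<close>

definition set_at :: "nat \<Rightarrow> (nat \<Rightarrow> real) \<Rightarrow> nat \<Rightarrow> nat set" where
  "set_at n R b = {i \<in> {1..n}. R (b + i) \<noteq> 0}"

text \<open>The target address comes first. In an oracle instruction the second address is the
  base address of the queried set.\<close>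

fun step :: "nat \<Rightarrow> (nat set \<Rightarrow> real) \<Rightarrow> (nat set \<Rightarrow> real) \<Rightarrow> instr \<Rightarrow> store \<Rightarrow> store" where
  "step n f c (NConst d k) (N, R) = (N(loc N d := k), R)"
| "step n f c (NMove d a) (N, R) = (N(loc N d := N (loc N a)), R)"
| "step n f c (NOp g d a b) (N, R) = (N(loc N d := index_fun g (N (loc N a)) (N (loc N b))), R)"
| "step n f c (RConst d k) (N, R) = (N, R(loc N d := of_int k))"
| "step n f c (RMove d a) (N, R) = (N, R(loc N d := R (loc N a)))"
| "step n f c (ROp g d a b) (N, R) = (N, R(loc N d := real_fun g (R (loc N a)) (R (loc N b))))"
| "step n f c (AskReward d b) (N, R) = (N, R(loc N d := f (set_at n R (loc N b))))"
| "step n f c (AskCost d b) (N, R) = (N, R(loc N d := c (set_at n R (loc N b))))"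

fun holds :: "test \<Rightarrow> store \<Rightarrow> bool" where
  "holds (NLess a b) (N, R) \<longleftrightarrow> N (loc N a) < N (loc N b)"
| "holds (NLeq a b) (N, R) \<longleftrightarrow> N (loc N a) \<le> N (loc N b)"
| "holds (RLess a b) (N, R) \<longleftrightarrow> R (loc N a) < R (loc N b)"
| "holds (RLeq a b) (N, R) \<longleftrightarrow> R (loc N a) \<le> R (loc N b)"

text \<open>\<open>Call p ns xs k d\<close> runs \<open>p\<close> as a procedure in a fresh memory, on the contents of the index
  cells \<open>ns\<close> and the real cells \<open>xs\<close>. Afterwards the real cells \<open>0, \<dots>, m\<close> of the procedure,
  with \<open>m\<close> the content of the caller's index cell \<open>k\<close>, are copied to the caller's real cells
  starting at \<open>d\<close>. Each cell passed or returned costs one step.\<close>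

datatype prog =
    Skip
  | Do instr
  | Seq prog prog
  | Branch test prog prog
  | While test prog
  | Call prog "addr list" "addr list" addr addr

definition load :: "'a::zero list \<Rightarrow> nat \<Rightarrow> 'a" where
  "load xs i = (if i < length xs then xs ! i else 0)"

definition copy_block :: "(nat \<Rightarrow> real) \<Rightarrow> nat \<Rightarrow> nat \<Rightarrow> (nat \<Rightarrow> real) \<Rightarrow> nat \<Rightarrow> real" where
  "copy_block R' m d R i = (if d \<le> i \<and> i \<le> d + m then R' (i - d) else R i)"

text \<open>\<open>exec n f c p s t s'\<close>: with value oracles \<open>f\<close> and \<open>c\<close> for subsets of \<open>{1..n}\<close>, program \<open>p\<close>
  started in store \<open>s\<close> halts after \<open>t\<close> steps in store \<open>s'\<close>.\<close>

inductive exec ::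
    "nat \<Rightarrow> (nat set \<Rightarrow> real) \<Rightarrow> (nat set \<Rightarrow> real) \<Rightarrow> prog \<Rightarrow> store \<Rightarrow> nat \<Rightarrow> store \<Rightarrow> bool"
  for n f c where
  Skip: "exec n f c Skip s 0 s"
| Do: "exec n f c (Do i) s 1 (step n f c i s)"
| Seq: "exec n f c p s t s' \<Longrightarrow> exec n f c q s' u s'' \<Longrightarrow> exec n f c (Seq p q) s (t + u) s''"
| BranchTrue: "holds b s \<Longrightarrow> exec n f c p s t s' \<Longrightarrow> exec n f c (Branch b p q) s (1 + t) s'"
| BranchFalse: "\<not> holds b s \<Longrightarrow> exec n f c q s t s' \<Longrightarrow> exec n f c (Branch b p q) s (1 + t) s'"
| WhileFalse: "\<not> holds b s \<Longrightarrow> exec n f c (While b p) s 1 s"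
| WhileTrue: "holds b s \<Longrightarrow> exec n f c p s t s' \<Longrightarrow> exec n f c (While b p) s' u s'' \<Longrightarrow>
    exec n f c (While b p) s (1 + t + u) s''"
| Call: "exec n f c p (load (map (\<lambda>a. N (loc N a)) ns), load (map (\<lambda>a. R (loc N a)) xs)) t (N', R') \<Longrightarrow>
    m = N (loc N k) \<Longrightarrow>
    exec n f c (Call p ns xs k d) (N, R) (1 + length ns + length xs + (m + 1) + t)
      (N, copy_block R' m (loc N d) R)"

lemma exec_deterministic:
  assumes "exec n f c p s t s'" and "exec n f c p s u s''"
  shows "t = u \<and> s' = s''"
  using assms
proof (induction arbitrary: u s'' rule: exec.induct)
  case (Skip s)
  then show ?case by (cases rule: exec.cases) simp_all
next
  case (Do i s)
  then show ?case by (cases rule: exec.cases) simp_all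
next
  case (Seq p s t s1 q v s2)
  from Seq.prems obtain t' v' s1' where "exec n f c p s t' s1'" "exec n f c q s1' v' s''" "u = t' + v'"
    by (cases rule: exec.cases) auto
  then show ?case using Seq.IH by metis
next
  case (BranchTrue b s p t s1 q)
  from BranchTrue.prems BranchTrue.hyps obtain t' where "exec n f c p s t' s''" "u = 1 + t'"
    by (cases rule: exec.cases) auto
  then show ?case using BranchTrue.IH by metis
next
  case (BranchFalse b s q t s1 p)
  from BranchFalse.prems BranchFalse.hyps obtain t' where "exec n f c q s t' s''" "u = 1 + t'"
    by (cases rule: exec.cases) auto
  then show ?case using BranchFalse.IH by metis
next
  case (WhileFalse b s p)
  from WhileFalse.prems WhileFalse.hyps show ?case by (cases rule: exec.cases) simp_all
next
  case (WhileTrue b s p t s1 v s2)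
  from WhileTrue.prems WhileTrue.hyps obtain t' v' s1' where "exec n f c p s t' s1'"
    "exec n f c (While b p) s1' v' s''" "u = 1 + t' + v'"
    by (cases rule: exec.cases) auto
  then show ?case using WhileTrue.IH by metis
next
  case (Call p N ns R xs t N' R' m k d)
  from Call.prems obtain t' N'' R'' where
    "exec n f c p (load (map (\<lambda>a. N (loc N a)) ns), load (map (\<lambda>a. R (loc N a)) xs)) t' (N'', R'')"
    "u = 1 + length ns + length xs + (m + 1) + t'" "s'' = (N, copy_block R'' m (loc N d) R)"
    by (cases rule: exec.cases) (use Call.hyps in simp_all)
  then show ?case using Call.IH by (metis prod.inject)
qed

text \<open>Every program receives \<open>n\<close> in index cell 0. A demand program also receives the contract
  in real cell 0 and returns a set at base address 0; a program for the optimal contract returns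
  it in real cell 0. All other cells are initially zero. In both cases one program serves all
  settings of the class, and its access to a setting is confined to the two value oracles.\<close>

definition poly_time_demand :: "setting set \<Rightarrow> prog \<Rightarrow> bool" where
  "poly_time_demand \<J> D \<longleftrightarrow> (\<exists>q :: nat poly. \<forall>J \<in> \<J>. \<forall>\<alpha> \<in> {0..1}. \<exists>t N R.
     exec (size_of J) (reward J) (cost J) D (load [size_of J], load [\<alpha>]) t (N, R) \<and>
     t \<le> poly q (size_of J) \<and> set_at (size_of J) R 0 = demand J \<alpha>)"

definition poly_time_optimal_contract :: "setting set \<Rightarrow> prog \<Rightarrow> bool" where
  "poly_time_optimal_contract \<J> P \<longleftrightarrow> (\<exists>q :: nat poly. \<forall>J \<in> \<J>. \<exists>t N R.
     exec (size_of J) (reward J) (cost J) P (load [size_of J], load []) t (N, R) \<and>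
     t \<le> poly q (size_of J) \<and> optimal_contract J (R 0))"

definition poly_many_critical_values :: "setting set \<Rightarrow> bool" where
  "poly_many_critical_values \<J> \<longleftrightarrow>
     (\<exists>q :: nat poly. \<forall>J \<in> \<J>. card (critical_values J) \<le> poly q (size_of J))"

end

theory Submission imports Defs begin

text \<open>The agent's optimal utility is the upper envelope of the lines \<open>\<alpha> f(S) - c(S)\<close>, and the
  principal's utility is maximal at the left end of one of its segments. The segments are visited
  from left to right. To find the right end of the current segment, intersect its line with the
  line demanded at some contract further right, starting with contract 1, and ask for the demand at
  the intersection \<open>\<gamma>\<close>. Either the current line is still optimal at \<open>\<gamma>\<close>, and then the next segment
  starts there, or the line demanded at \<open>\<gamma>\<close> is flatter than the one intersected with and replaces
  it. Distinct slopes occurring as demand belong to distinct critical values, hence a quadratic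
  number of queries suffices. Only a constant number of lines is kept in memory.\<close>

section \<open>Walking along the envelope\<close>

text \<open>\<open>slope x\<close> and \<open>offset x\<close> stand for reward and cost of the set
  demanded at contract \<open>x\<close>. Forgetting the sets leaves a problem about lines in the
  plane; \<open>steepest\<close> is the tie-breaking in favor of larger rewards.\<close>

locale envelope =
  fixes slope offset :: "real \<Rightarrow> real"
  assumes optimal: "\<And>x y. x \<in> {0..1} \<Longrightarrow> y \<in> {0..1} \<Longrightarrow>
      x * slope y - offset y \<le> x * slope x - offset x"
    and steepest: "\<And>x y. x \<in> {0..1} \<Longrightarrow> y \<in> {0..1} \<Longrightarrow>
      x * slope y - offset y = x * slope x - offset x \<Longrightarrow> slope y \<le> slope x"
    and slope_nonneg: "\<And>x. x \<in> {0..1} \<Longrightarrow> 0 \<le> slope x"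
    and finite_slopes: "finite (slope ` {0..1})"
begin

definition payoff :: "real \<Rightarrow> real" where
  "payoff x = (1 - x) * slope x"

text \<open>The contracts \<open>a\<close> and \<open>b\<close> themselves are not needed by the algorithm, only their lines.\<close>

definition explored :: "real \<Rightarrow> real \<Rightarrow> real \<Rightarrow> real \<Rightarrow> real \<Rightarrow> real \<Rightarrow> bool" where
  "explored best v fa ca fb cb \<longleftrightarrow> best \<in> {0..1} \<and> v = payoff best \<and>
     (\<exists>a b. 0 \<le> a \<and> a \<le> b \<and> b \<le> 1 \<and> fa = slope a \<and> ca = offset a \<and> fb = slope b \<and> cb = offset b \<and>
        (slope a < slope 1 \<longrightarrow> slope a < slope b) \<and> (\<forall>x\<in>{0..a}. payoff x \<le> v))"

lemma exploredI:
  assumes "0 \<le> a" "a \<le> b" "b \<le> 1" "slope a < slope 1 \<Longrightarrow> slope a < slope b"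
    and "best \<in> {0..1}" "v = payoff best" "\<And>x. 0 \<le> x \<Longrightarrow> x \<le> a \<Longrightarrow> payoff x \<le> v"
  shows "explored best v (slope a) (offset a) (slope b) (offset b)"
  unfolding explored_def using assms by (intro conjI exI[of _ a] exI[of _ b]) auto

text \<open>Adding the optimality conditions at \<open>x\<close> and at \<open>y\<close> cancels the
  offsets.\<close>

lemma slope_mono:
  assumes "0 \<le> x" "x \<le> y" "y \<le> 1"
  shows "slope x \<le> slope y"
proof (cases "x = y")
  case False
  have "x * slope y - offset y \<le> x * slope x - offset x"
    "y * slope x - offset x \<le> y * slope y - offset y"
    using assms by (auto intro: optimal)
  then have "0 \<le> (y - x) * (slope y - slope x)" by (simp add: algebra_simps)
  then show ?thesis using False assms by (simp add: zero_le_mult_iff)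
qed simp

text \<open>At \<open>a\<close> the steeper line is strictly lower, since a tie would have been
  resolved in its favor; at \<open>b\<close> it is at least as high. So the lines meet after
  \<open>a\<close> and not after \<open>b\<close>.\<close>

lemma crossing_between:
  assumes "0 \<le> a" "a \<le> b" "b \<le> 1" "slope a < slope b"
  defines "g \<equiv> (offset b - offset a) / (slope b - slope a)"
  shows "a < g" "g \<le> b" "g * slope b - offset b = g * slope a - offset a"
proof -
  have "a * slope b - offset b \<noteq> a * slope a - offset a"
    using steepest[of a b] assms by auto
  then have "a * slope b - offset b < a * slope a - offset a"
    using optimal[of a b] assms by auto
  then show "a < g" using assms by (simp add: g_def field_simps)
  have "b * slope a - offset a \<le> b * slope b - offset b"
    using optimal[of b a] assms by auto
  then show "g \<le> b" using assms by (simp add: g_def field_simps)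
  have "g * (slope b - slope a) = offset b - offset a" using assms by (simp add: g_def)
  then show "g * slope b - offset b = g * slope a - offset a" by (simp add: algebra_simps)
qed

section \<open>Invariant of the walk\<close>

lemma explored_initially:
  "explored 0 (slope 0) (slope 0) (offset 0) (slope 1) (offset 1)"
  by (rule exploredI) (auto simp: payoff_def)

text \<open>The guard \<open>fa < slope 1\<close> activates the implication in
  \<open>explored\<close>, so the denominator is positive and the crossing may be queried as a
  contract.\<close>

lemma explored_crossing:
  assumes "explored best v fa ca fb cb" "fa < slope 1"
  shows "(cb - ca) / (fb - fa) \<in> {0..1}"
proof -
  obtain a b where ab: "0 \<le> a" "a \<le> b" "b \<le> 1" "slope a < slope b"
    and "fa = slope a" "ca = offset a" "fb = slope b" "cb = offset b"
    using assms by (auto simp: explored_def)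
  moreover define g where "g = (offset b - offset a) / (slope b - slope a)"
  moreover have "a < g" "g \<le> b" using crossing_between[OF ab] by (simp_all add: g_def)
  ultimately show ?thesis using ab by (metis atLeastAtMost_iff less_imp_le order_trans)
qed

text \<open>The current line is optimal at both \<open>a\<close> and \<open>g\<close>. By convexity
  no slope demanded in between exceeds \<open>fa\<close>, so payoffs there are at most
  \<open>(1 - a) * fa\<close> and only \<open>g\<close> itself can improve on
  \<open>v\<close>.\<close>

lemma explored_advance:
  fixes g :: real
  assumes ex: "explored best v fa ca fb cb" and fa: "fa < slope 1"
    and g: "g = (cb - ca) / (fb - fa)" and opt: "g * slope g - offset g \<le> g * fa - ca"
  shows "v < payoff g \<Longrightarrow> explored g (payoff g) (slope g) (offset g) (slope 1) (offset 1)"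
    and "\<not> v < payoff g \<Longrightarrow> explored best v (slope g) (offset g) (slope 1) (offset 1)"
    and "fa < slope g"
proof -
  obtain a b where ab: "0 \<le> a" "a \<le> b" "b \<le> 1" "slope a < slope b"
    and eqs: "fa = slope a" "ca = offset a" "fb = slope b" "cb = offset b"
    and low: "\<forall>x\<in>{0..a}. payoff x \<le> v" and best: "best \<in> {0..1}" "v = payoff best"
    using ex fa by (auto simp: explored_def)
  have ag: "a < g" and gb: "g \<le> b" and cross: "g * slope b - offset b = g * slope a - offset a"
    using crossing_between[OF ab] by (simp_all add: g eqs)
  have g01: "g \<in> {0..1}" using ab ag gb by auto
  \<comment> \<open>The line of \<open>b\<close> passes through the same point of the envelope, so
    tie-breaking at \<open>g\<close> yields a slope of at least \<open>slope b\<close>.\<close>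
  have "g * slope b - offset b = g * slope g - offset g"
    using optimal[of g b] opt cross g01 ab by (simp add: eqs)
  then have "slope b \<le> slope g" using steepest[of g b] g01 ab by auto
  then show "fa < slope g" using ab by (simp add: eqs)
  have before: "payoff x \<le> v" if x: "0 \<le> x" "x < g" for x
  proof (cases "x \<le> a")
    case False
    have x01: "x \<in> {0..1}" "a \<in> {0..1}" using x g01 ab by auto
    \<comment> \<open>The line of \<open>x\<close> is at least as high as the current one at
      \<open>x\<close> and at most as high at \<open>g\<close>, which lies to the right, so it is
      not steeper.\<close>
    have "x * slope a - offset a \<le> x * slope x - offset x"
      "g * slope x - offset x \<le> g * slope g - offset g"
      using optimal x01 g01 by auto
    then have "(g - x) * (slope x - slope a) \<le> 0" using opt by (simp add: eqs algebra_simps)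
    then have "slope x \<le> slope a" using x by (simp add: mult_le_0_iff)
    then have "(1 - x) * slope x \<le> (1 - x) * slope a" using x01 by (intro mult_left_mono) auto
    also have "\<dots> \<le> (1 - a) * slope a"
      using False slope_nonneg[OF x01(2)] by (intro mult_right_mono) auto
    also have "\<dots> \<le> v" using low ab by (auto simp: payoff_def)
    finally show ?thesis by (simp add: payoff_def)
  qed (use low x in auto)
  show "explored g (payoff g) (slope g) (offset g) (slope 1) (offset 1)" if "v < payoff g"
  proof (rule exploredI)
    show "payoff x \<le> payoff g" if "0 \<le> x" "x \<le> g" for x
      using before[OF that(1)] \<open>v < payoff g\<close> that(2) by (cases "x = g") auto
  qed (use g01 in auto)
  show "explored best v (slope g) (offset g) (slope 1) (offset 1)" if "\<not> v < payoff g"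
  proof (rule exploredI)
    show "payoff x \<le> v" if "0 \<le> x" "x \<le> g" for x
      using before[OF that(1)] \<open>\<not> v < payoff g\<close> that(2) by (cases "x = g") auto
  qed (use g01 best in auto)
qed

text \<open>The new line runs strictly above the crossing point, but not above the lines of
  \<open>a\<close> and \<open>b\<close> at their own contracts. So its slope lies strictly between
  theirs, and \<open>g\<close> takes over the role of \<open>b\<close>.\<close>

lemma explored_refine:
  fixes g :: real
  assumes ex: "explored best v fa ca fb cb" and fa: "fa < slope 1"
    and g: "g = (cb - ca) / (fb - fa)" and opt: "\<not> g * slope g - offset g \<le> g * fa - ca"
  shows "explored best v fa ca (slope g) (offset g)" and "slope g < fb"
proof -
  obtain a b where ab: "0 \<le> a" "a \<le> b" "b \<le> 1" "slope a < slope b"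
    and eqs: "fa = slope a" "ca = offset a" "fb = slope b" "cb = offset b"
    and low: "\<forall>x\<in>{0..a}. payoff x \<le> v" and best: "best \<in> {0..1}" "v = payoff best"
    using ex fa by (auto simp: explored_def)
  have ag: "a < g" and gb: "g \<le> b" and cross: "g * slope b - offset b = g * slope a - offset a"
    using crossing_between[OF ab] by (simp_all add: g eqs)
  have above: "g * slope b - offset b < g * slope g - offset g" using opt cross by (simp add: eqs)
  then have "g < b" using gb by (cases "g = b") auto
  have "b * slope g - offset g \<le> b * slope b - offset b" using optimal[of b g] ab ag gb by auto
  then have "0 < (b - g) * (slope b - slope g)" using above by (simp add: algebra_simps)
  then show "slope g < fb" using \<open>g < b\<close> by (simp add: zero_less_mult_iff eqs)
  have "a * slope g - offset g \<le> a * slope a - offset a" using optimal[of a g] ab ag gb by auto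
  then have "0 < (g - a) * (slope g - slope a)" using above cross by (simp add: algebra_simps)
  then have "slope a < slope g" using ag by (simp add: zero_less_mult_iff)
  then show "explored best v fa ca (slope g) (offset g)"
    using ab ag gb low best unfolding eqs by (intro exploredI) auto
qed

text \<open>By \<open>slope_mono\<close> the current slope is already maximal, so to the right of
  \<open>a\<close> the factor \<open>1 - x\<close> shrinks without any gain in slope.\<close>

lemma explored_finished:
  assumes ex: "explored best v fa ca fb cb" and fa: "\<not> fa < slope 1" and x: "x \<in> {0..1}"
  shows "best \<in> {0..1}" and "payoff x \<le> payoff best"
proof -
  obtain a where a: "0 \<le> a" "a \<le> 1" "fa = slope a"
    and low: "\<forall>x\<in>{0..a}. payoff x \<le> v" and best: "best \<in> {0..1}" "v = payoff best"
    using ex by (auto simp: explored_def)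
  show "best \<in> {0..1}" by fact
  show "payoff x \<le> payoff best"
  proof (cases "x \<le> a")
    case False
    have "slope x \<le> slope a" using slope_mono[of x 1] x fa a by auto
    then have "(1 - x) * slope x \<le> (1 - x) * slope a" using x by (intro mult_left_mono) auto
    also have "\<dots> \<le> (1 - a) * slope a"
      using False slope_nonneg[of a] a by (intro mult_right_mono) auto
    also have "\<dots> \<le> payoff best" using low a best by (auto simp: payoff_def)
    finally show ?thesis by (simp add: payoff_def)
  qed (use low best x in auto)
qed

text \<open>A lexicographic order encoded in one number. The factor exceeds every value of the
  second count, so an advance may reset that count arbitrarily.\<close>

definition remaining :: "real \<Rightarrow> real \<Rightarrow> nat" where
  "remaining fa fb =
     card {v \<in> slope ` {0..1}. fa < v} * (card (slope ` {0..1}) + 1) + card {v \<in> slope ` {0..1}. v < fb}"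

lemma card_slopes_le: "card {v \<in> slope ` {0..1}. P v} \<le> card (slope ` {0..1})"
  using finite_slopes by (auto intro: card_mono)

lemma remaining_le:
  "remaining fa fb \<le> card (slope ` {0..1}) * (card (slope ` {0..1}) + 1) + card (slope ` {0..1})"
  unfolding remaining_def by (intro add_mono mult_le_mono1 card_slopes_le)

lemma remaining_advance:
  assumes "g \<in> {0..1}" "fa < slope g"
  shows "remaining (slope g) fb' < remaining fa fb"
proof -
  let ?V = "slope ` {0..1}"
  have "card {v \<in> ?V. slope g < v} < card {v \<in> ?V. fa < v}"
    using assms finite_slopes by (intro psubset_card_mono) auto
  then have "(card {v \<in> ?V. slope g < v} + 1) * (card ?V + 1) \<le> card {v \<in> ?V. fa < v} * (card ?V + 1)"
    by (intro mult_le_mono1) simp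
  moreover have "card {v \<in> ?V. v < fb'} \<le> card ?V" by (rule card_slopes_le)
  ultimately show ?thesis by (simp add: remaining_def)
qed

lemma remaining_refine:
  assumes "g \<in> {0..1}" "slope g < fb"
  shows "remaining fa (slope g) < remaining fa fb"
proof -
  let ?V = "slope ` {0..1}"
  have "card {v \<in> ?V. v < slope g} < card {v \<in> ?V. v < fb}"
    using assms finite_slopes by (intro psubset_card_mono) auto
  then show ?thesis by (simp add: remaining_def)
qed

end


section \<open>Demand and critical values\<close>

lemma demand_subset: "valid_setting J \<Longrightarrow> demand J x \<subseteq> actions J"
  using demand_favored[of J x] by (simp add: favored_responses_def best_responses_def)

lemma demand_optimal:
  "valid_setting J \<Longrightarrow> T \<subseteq> actions J \<Longrightarrow> agent_utility J x T \<le> agent_utility J x (demand J x)"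
  using demand_favored[of J x] by (simp add: favored_responses_def best_responses_def)

lemma demand_steepest:
  assumes "valid_setting J" "T \<subseteq> actions J" "agent_utility J x T = agent_utility J x (demand J x)"
  shows "reward J T \<le> reward J (demand J x)"
  using assms demand_favored[of J x] by (simp add: favored_responses_def best_responses_def)

text \<open>Equal reward and equal utility force equal cost. Hence two contracts that share one
  favored response share all of them, and the tie order gives them the same demand.\<close>

lemma favored_responses_eq:
  assumes "S \<in> favored_responses J x"
  shows "favored_responses J x =
    {T. T \<subseteq> actions J \<and> reward J T = reward J S \<and> cost J T = cost J S}"
proof -
  have S: "S \<subseteq> actions J" "\<And>T. T \<subseteq> actions J \<Longrightarrow> agent_utility J x T \<le> agent_utility J x S"
    "\<And>T. T \<in> best_responses J x \<Longrightarrow> reward J T \<le> reward J S" "S \<in> best_responses J x"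
    using assms by (auto simp: favored_responses_def best_responses_def)
  show ?thesis
  proof (intro set_eqI iffI)
    fix T assume T: "T \<in> favored_responses J x"
    then have TA: "T \<subseteq> actions J" and r: "reward J T = reward J S"
      using S by (auto simp: favored_responses_def best_responses_def intro: antisym)
    have "agent_utility J x T = agent_utility J x S"
      using T S(1,2) TA by (intro antisym) (auto simp: favored_responses_def best_responses_def)
    then show "T \<in> {T. T \<subseteq> actions J \<and> reward J T = reward J S \<and> cost J T = cost J S}"
      using TA r by (simp add: agent_utility_def)
  next
    fix T assume "T \<in> {T. T \<subseteq> actions J \<and> reward J T = reward J S \<and> cost J T = cost J S}"
    then show "T \<in> favored_responses J x"
      using S(2,3) by (auto simp: favored_responses_def best_responses_def agent_utility_def)
  qed
qed

text \<open>The witness is the left end of the segment of the envelope that belongs to \<open>demand J x\<close>.\<close>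

lemma ex_critical_value:
  assumes J: "valid_setting J" and x: "x \<in> {0..1}"
  shows "\<exists>l \<in> critical_values J. demand J l = demand J x"
proof -
  define S where "S = demand J x"
  define flat where "flat = {T \<in> Pow (actions J). reward J T < reward J S}"
  \<comment> \<open>From contract \<open>cut T\<close> on, \<open>S\<close> is at least as good as
    the flatter \<open>T\<close>. The maximum below includes 0 because \<open>flat\<close> may be
    empty and cuts may be negative.\<close>
  define cut where "cut T = (cost J S - cost J T) / (reward J S - reward J T)" for T
  define l where "l = Max (insert 0 (cut ` flat))"
  have SA: "S \<subseteq> actions J" unfolding S_def by (rule demand_subset[OF J])
  have fin: "finite (insert 0 (cut ` flat))" by (simp add: flat_def actions_def)
  have l_ge: "0 \<le> l" "\<And>T. T \<in> flat \<Longrightarrow> cut T \<le> l"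
    unfolding l_def using fin by (auto intro: Max_ge)
  have l_in: "l = 0 \<or> (\<exists>T \<in> flat. l = cut T)"
    using Max_in[OF fin] by (auto simp: l_def)
  have cut_iff: "cut T \<le> y \<longleftrightarrow> agent_utility J y T \<le> agent_utility J y S" if "T \<in> flat" for T y
    using that by (auto simp: cut_def flat_def agent_utility_def field_simps)
  have Sx: "agent_utility J x T \<le> agent_utility J x S" if "T \<subseteq> actions J" for T
    using demand_optimal[OF J that] by (simp add: S_def)
  have lx: "l \<le> x"
    using l_in x cut_iff Sx by (auto simp: flat_def)
  \<comment> \<open>A steeper set is strictly worse than \<open>S\<close> at \<open>x\<close>, as a
    tie would favor it, and it gains nothing on the way left to \<open>l\<close>.\<close>
  have steep: "agent_utility J l T < agent_utility J l S"
    if "T \<subseteq> actions J" "reward J S < reward J T" for T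
  proof -
    have "agent_utility J x T < agent_utility J x S"
      using Sx[OF that(1)] demand_steepest[OF J that(1), of x] that(2) unfolding S_def by linarith
    moreover have "l * (reward J T - reward J S) \<le> x * (reward J T - reward J S)"
      using lx that by (intro mult_right_mono) auto
    ultimately show ?thesis by (simp add: agent_utility_def algebra_simps)
  qed
  have Sl: "agent_utility J l T \<le> agent_utility J l S" if T: "T \<subseteq> actions J" for T
  proof (cases "reward J T" "reward J S" rule: linorder_cases)
    case less
    then have "T \<in> flat" using T by (simp add: flat_def)
    then show ?thesis using cut_iff[of T l] l_ge(2)[of T] by simp
  next
    case equal
    then show ?thesis using Sx[OF T] by (simp add: agent_utility_def)
  next
    case greater
    then show ?thesis using steep[OF T] by simp
  qed
  have "reward J T \<le> reward J S" if "T \<in> best_responses J l" for T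
  proof (rule ccontr)
    assume "\<not> reward J T \<le> reward J S"
    moreover have "T \<subseteq> actions J" "agent_utility J l S \<le> agent_utility J l T"
      using that SA by (simp_all add: best_responses_def)
    ultimately show False using steep[of T] by simp
  qed
  then have "S \<in> favored_responses J l"
    using SA Sl by (simp add: favored_responses_def best_responses_def)
  moreover have "S \<in> favored_responses J x" unfolding S_def by (rule demand_favored[OF J])
  ultimately have "favored_responses J l = favored_responses J x"
    using favored_responses_eq by metis
  then have l: "demand J l = S" unfolding S_def by (rule demand_cong)
  \<comment> \<open>The flatter set whose cut is \<open>l\<close> strictly beats \<open>S\<close> to
    the left of \<open>l\<close>.\<close>
  have left: "demand J y \<noteq> S" if yl: "y < l" "l \<noteq> 0" for y
  proof
    assume y: "demand J y = S"
    obtain T where T: "T \<in> flat" "l = cut T" using l_in yl(2) by blast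
    then have "\<not> agent_utility J y T \<le> agent_utility J y S"
      using cut_iff[OF T(1), of y] yl(1) by simp
    then show False using demand_optimal[OF J, of T y] T(1) y by (simp add: flat_def)
  qed
  have "l \<in> critical_values J"
  proof (cases "l = 0")
    case False
    have "\<exists>y\<in>{0..1}. l - e < y \<and> y < l \<and> demand J y \<noteq> demand J l" if "e > 0" for e :: real
    proof (intro bexI conjI)
      \<comment> \<open>The witness lies half of \<open>e\<close> to the left, cut off at 0 so as to
        remain a contract.\<close>
      show "l - e < max 0 (l - e / 2)" "max 0 (l - e / 2) < l" "max 0 (l - e / 2) \<in> {0..1}"
        using that False l_ge lx x by auto
      then show "demand J (max 0 (l - e / 2)) \<noteq> demand J l" using left False l by auto
    qed
    then show ?thesis using l_ge lx x by (auto simp: critical_values_def)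
  qed (simp add: critical_values_def)
  then show ?thesis using l by (auto simp: S_def)
qed

lemma demand_rewards_subset:
  assumes "valid_setting J"
  shows "(\<lambda>x. reward J (demand J x)) ` {0..1} \<subseteq> (\<lambda>x. reward J (demand J x)) ` critical_values J"
proof
  fix v assume "v \<in> (\<lambda>x. reward J (demand J x)) ` {0..1}"
  then obtain x where x: "x \<in> {0..1}" "v = reward J (demand J x)" by blast
  obtain l where "l \<in> critical_values J" "demand J l = demand J x"
    using ex_critical_value[OF assms x(1)] by blast
  then show "v \<in> (\<lambda>x. reward J (demand J x)) ` critical_values J"
    using x(2) by (intro image_eqI[of _ _ l]) simp_all
qed

text \<open>Here the number of critical values comes to bound the number of slopes, and with it the
  number of queries.\<close>

lemma card_demand_rewards:
  assumes "valid_setting J"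
  shows "card ((\<lambda>x. reward J (demand J x)) ` {0..1}) \<le> card (critical_values J)"
  by (rule surj_card_le[OF finite_critical_values[OF assms] demand_rewards_subset[OF assms]])

lemma envelope_demand:
  assumes J: "valid_setting J"
  shows "envelope (\<lambda>x. reward J (demand J x)) (\<lambda>x. cost J (demand J x))"
proof
  fix x y :: real
  show "x * reward J (demand J y) - cost J (demand J y) \<le> x * reward J (demand J x) - cost J (demand J x)"
    using demand_optimal[OF J demand_subset[OF J], of x y] by (simp add: agent_utility_def)
  show "reward J (demand J y) \<le> reward J (demand J x)"
    if "x * reward J (demand J y) - cost J (demand J y) = x * reward J (demand J x) - cost J (demand J x)"
    using demand_steepest[OF J demand_subset[OF J], of x y] that by (simp add: agent_utility_def)
  show "0 \<le> reward J (demand J x)"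
    using J demand_subset[OF J] by (simp add: valid_setting_def)
next
  show "finite ((\<lambda>x. reward J (demand J x)) ` {0..1})"
    using demand_rewards_subset[OF J] finite_critical_values[OF J]
    by (meson finite_imageI finite_subset)
qed


section \<open>Time-bounded execution\<close>

text \<open>A timed Hoare triple for total correctness, with the single start store \<open>s\<close>
  as precondition.\<close>

definition halts_within ::
    "nat \<Rightarrow> (nat set \<Rightarrow> real) \<Rightarrow> (nat set \<Rightarrow> real) \<Rightarrow> prog \<Rightarrow> store \<Rightarrow> nat \<Rightarrow> (store \<Rightarrow> bool) \<Rightarrow> bool" where
  "halts_within n f c p s T Q \<longleftrightarrow> (\<exists>t s'. exec n f c p s t s' \<and> t \<le> T \<and> Q s')"

definition block :: "instr list \<Rightarrow> prog" where
  "block is = foldr (\<lambda>i. Seq (Do i)) is Skip"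

lemma halts_within_mono:
  "halts_within n f c p s T Q \<Longrightarrow> T \<le> T' \<Longrightarrow> (\<And>s'. Q s' \<Longrightarrow> Q' s') \<Longrightarrow> halts_within n f c p s T' Q'"
  unfolding halts_within_def by (meson order_trans)

lemma halts_within_Seq:
  assumes "halts_within n f c p s T Q" and "\<And>s'. Q s' \<Longrightarrow> halts_within n f c q s' U Q'"
  shows "halts_within n f c (Seq p q) s (T + U) Q'"
  using assms unfolding halts_within_def by (meson add_mono exec.Seq)

text \<open>Formulated with the remaining budget \<open>T - 1\<close>, so that a concrete bound is
  used up step by step; \<open>1 \<le> T\<close> guards against truncated subtraction.\<close>

lemma halts_within_Branch:
  assumes "halts_within n f c (if holds b s then p else q) s (T - 1) Q" and "1 \<le> T"
  shows "halts_within n f c (Branch b p q) s T Q"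
proof -
  obtain t s' where e: "exec n f c (if holds b s then p else q) s t s'" "t \<le> T - 1" "Q s'"
    using assms(1) by (auto simp: halts_within_def)
  then have "exec n f c (Branch b p q) s (1 + t) s'"
    by (cases "holds b s") (auto intro: exec.BranchTrue[simplified] exec.BranchFalse[simplified])
  moreover have "1 + t \<le> T" using e assms(2) by simp
  ultimately show ?thesis using e(3) unfolding halts_within_def by blast
qed

text \<open>The closing \<open>Skip\<close> is free, so the time is exact.\<close>

lemma exec_block: "exec n f c (block is) s (length is) (fold (step n f c) is s)"
proof (induction "is" arbitrary: s)
  case (Cons i "is")
  have "exec n f c (Seq (Do i) (block is)) s (1 + length is) (fold (step n f c) is (step n f c i s))"
    by (rule exec.Seq[OF exec.Do Cons.IH])
  then show ?case by (simp add: block_def)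
qed (simp add: block_def exec.Skip)

lemma halts_within_block:
  "Q (fold (step n f c) is s) \<Longrightarrow> length is \<le> T \<Longrightarrow> halts_within n f c (block is) s T Q"
  unfolding halts_within_def using exec_block by blast

lemma halts_within_block_Seq:
  assumes "halts_within n f c q (fold (step n f c) is s) (T - length is) Q" and "length is \<le> T"
  shows "halts_within n f c (Seq (block is) q) s T Q"
proof -
  have "halts_within n f c (Seq (block is) q) s (length is + (T - length is)) Q"
    by (rule halts_within_Seq[where Q = "\<lambda>s'. s' = fold (step n f c) is s"],
        rule halts_within_block) (use assms(1) in simp_all)
  then show ?thesis using assms(2) by simp
qed

text \<open>A round costs at most \<open>T\<close> steps and one test, and it lowers
  \<open>\<Phi>\<close>. The final \<open>+ 1\<close> pays for the failing test.\<close>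

lemma halts_within_While:
  fixes \<Phi> :: "store \<Rightarrow> nat"
  assumes body: "\<And>s. I s \<Longrightarrow> holds b s \<Longrightarrow> halts_within n f c p s T (\<lambda>s'. I s' \<and> \<Phi> s' < \<Phi> s)"
    and "I s"
  shows "halts_within n f c (While b p) s (\<Phi> s * (T + 1) + 1) (\<lambda>s'. I s' \<and> \<not> holds b s')"
  using \<open>I s\<close>
proof (induction "\<Phi> s" arbitrary: s rule: less_induct)
  case less
  show ?case
  proof (cases "holds b s")
    case False
    then show ?thesis
      using less.prems exec.WhileFalse[OF False] unfolding halts_within_def by (metis le_add2)
  next
    case True
    obtain t s1 where 1: "exec n f c p s t s1" "t \<le> T" "I s1" "\<Phi> s1 < \<Phi> s"
      using body[OF less.prems True] by (auto simp: halts_within_def)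
    obtain u s2 where 2: "exec n f c (While b p) s1 u s2" "u \<le> \<Phi> s1 * (T + 1) + 1"
        "I s2" "\<not> holds b s2"
      using less.hyps[OF 1(4,3)] by (auto simp: halts_within_def)
    have "(\<Phi> s1 + 1) * (T + 1) \<le> \<Phi> s * (T + 1)" using 1(4) by (intro mult_le_mono1) simp
    then have "1 + t + u \<le> \<Phi> s * (T + 1) + 1" using 1(2) 2(2) by simp
    then show ?thesis
      using exec.WhileTrue[OF True 1(1) 2(1)] 2(3,4) unfolding halts_within_def by blast
  qed
qed


section \<open>The program\<close>

text \<open>Real cells: 0 best contract so far, 1 its payoff, 2 and 3 reward and cost of the current line,
  4 and 5 those of the line to intersect with, 6 and 7 those of the line demanded at contract 1,
  8 the contract to ask for, 9 and 10 reward and cost of its demand, 11 the constant 1, 12 and 13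
  scratch, from 14 on the demanded set. Index cell 0 always holds the number of actions.\<close>

definition consult :: "prog \<Rightarrow> prog" where
  "consult D = Seq (Call D [Dir 0] [Dir 8] (Dir 0) (Dir 14))
     (block [AskReward (Dir 9) (Dir 14), AskCost (Dir 10) (Dir 14)])"

text \<open>The last two instructions of the first block leave the principal's payoff at the queried
  contract in cell 12.\<close>

definition advance :: prog where
  "advance = Seq (block [RMove (Dir 2) (Dir 9), RMove (Dir 3) (Dir 10), RMove (Dir 4) (Dir 6), RMove (Dir 5) (Dir 7),
        ROp RSub (Dir 12) (Dir 11) (Dir 8), ROp RMul (Dir 12) (Dir 12) (Dir 9)])
     (Branch (RLess (Dir 1) (Dir 12)) (block [RMove (Dir 1) (Dir 12), RMove (Dir 0) (Dir 8)]) (block []))"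

text \<open>Cells 12 and 13 hold the agent's utility at the queried contract, for the current line
  and for the demanded set.\<close>

definition decide :: prog where
  "decide = Branch (RLeq (Dir 13) (Dir 12)) advance
     (block [RMove (Dir 4) (Dir 9), RMove (Dir 5) (Dir 10)])"

definition round_prog :: "prog \<Rightarrow> prog" where
  "round_prog D = Seq (block [ROp RSub (Dir 12) (Dir 5) (Dir 3), ROp RSub (Dir 13) (Dir 4) (Dir 2),
        ROp RDiv (Dir 8) (Dir 12) (Dir 13)])
     (Seq (consult D)
       (Seq (block [ROp RMul (Dir 12) (Dir 8) (Dir 2), ROp RSub (Dir 12) (Dir 12) (Dir 3),
              ROp RMul (Dir 13) (Dir 8) (Dir 9), ROp RSub (Dir 13) (Dir 13) (Dir 10)])
         decide))"

definition init_prog :: "prog \<Rightarrow> prog" where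
  "init_prog D = Seq (block [RConst (Dir 11) 1, RConst (Dir 8) 0])
     (Seq (consult D)
       (Seq (block [RConst (Dir 0) 0, RMove (Dir 1) (Dir 9), RMove (Dir 2) (Dir 9), RMove (Dir 3) (Dir 10),
              RMove (Dir 8) (Dir 11)])
         (Seq (consult D)
           (block [RMove (Dir 4) (Dir 9), RMove (Dir 5) (Dir 10), RMove (Dir 6) (Dir 9), RMove (Dir 7) (Dir 10)]))))"

definition contract_prog :: "prog \<Rightarrow> prog" where
  "contract_prog D = Seq (init_prog D) (While (RLess (Dir 2) (Dir 6)) (round_prog D))"

section \<open>Correctness and running time of the program\<close>

lemma set_at_copy_block: "set_at n (copy_block R' n d R) d = set_at n R' 0"
  by (auto simp: set_at_def copy_block_def)

lemma set_at_cong: "(\<And>i. i \<in> {1..n} \<Longrightarrow> R (b + i) = R' (b + i)) \<Longrightarrow> set_at n R b = set_at n R' b"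
  by (auto simp: set_at_def)

text \<open>The demand program enters only through the line of its answer and a step bound
  \<open>B\<close> common to all contracts.\<close>

locale contract_run = envelope slope offset for slope offset :: "real \<Rightarrow> real" +
  fixes n :: nat and f c :: "nat set \<Rightarrow> real" and D :: prog and B :: nat
  assumes demand_run: "\<And>x. x \<in> {0..1} \<Longrightarrow> \<exists>t N R. exec n f c D (load [n], load [x]) t (N, R) \<and> t \<le> B \<and>
    f (set_at n R 0) = slope x \<and> c (set_at n R 0) = offset x"
begin

lemma halts_within_consult:
  assumes "R 8 \<in> {0..1}"
  shows "halts_within n f c (consult D) (load [n], R) (n + 6 + B) (\<lambda>s'. \<exists>R'. s' = (load [n], R') \<and>
    R' 9 = slope (R 8) \<and> R' 10 = offset (R 8) \<and> (\<forall>i < 14. i \<noteq> 9 \<longrightarrow> i \<noteq> 10 \<longrightarrow> R' i = R i))"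
proof -
  obtain t N' R' where D: "exec n f c D (load [n], load [R 8]) t (N', R')" "t \<le> B"
      "f (set_at n R' 0) = slope (R 8)" "c (set_at n R' 0) = offset (R 8)"
    using demand_run[OF assms] by blast
  have n: "load [n] 0 = n" by (simp add: load_def)
  define R1 where "R1 = copy_block R' n 14 R"
  \<comment> \<open>The overhead is one step for the call, two for the arguments and
    \<open>n + 1\<close> for the returned cells.\<close>
  have call: "exec n f c (Call D [Dir 0] [Dir 8] (Dir 0) (Dir 14)) (load [n], R) (n + 4 + t) (load [n], R1)"
    using exec.Call[of n f c D "load [n]" "[Dir 0]" R "[Dir 8]" t N' R' n "Dir 0" "Dir 14"] D(1) n
    by (simp add: R1_def add_ac eval_nat_numeral)
  have S: "set_at n R1 14 = set_at n R' 0" by (simp add: R1_def set_at_copy_block)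
  \<comment> \<open>Cell 9 lies below the block of the demanded set, so storing the reward does not
    disturb the cost query.\<close>
  have S9: "set_at n (R1(9 := v)) 14 = set_at n R' 0" for v
    using S set_at_cong[of n "R1(9 := v)" 14 R1] by simp
  have R1: "R1 i = R i" if "i < 14" for i using that by (simp add: R1_def copy_block_def)
  have "halts_within n f c (consult D) (load [n], R) ((n + 4 + B) +
    length [AskReward (Dir 9) (Dir 14), AskCost (Dir 10) (Dir 14)]) (\<lambda>s'. \<exists>R'. s' = (load [n], R') \<and>
    R' 9 = slope (R 8) \<and> R' 10 = offset (R 8) \<and> (\<forall>i < 14. i \<noteq> 9 \<longrightarrow> i \<noteq> 10 \<longrightarrow> R' i = R i))"
    unfolding consult_def
  proof (rule halts_within_Seq)
    show "halts_within n f c (Call D [Dir 0] [Dir 8] (Dir 0) (Dir 14)) (load [n], R) (n + 4 + B)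
      (\<lambda>s'. s' = (load [n], R1))"
      unfolding halts_within_def using call D(2) by auto
  qed (rule halts_within_block, use S S9 R1 D(3,4) in simp_all)
  then show ?thesis by (simp add: add_ac)
qed

text \<open>Only what survives a round is recorded: cells 8, 9, 10, 12, 13 and the block from 14 on
  are written in each round before they are read.\<close>

definition loop_inv :: "store \<Rightarrow> bool" where
  "loop_inv s \<longleftrightarrow> (\<exists>R. s = (load [n], R) \<and> explored (R 0) (R 1) (R 2) (R 3) (R 4) (R 5) \<and>
     R 6 = slope 1 \<and> R 7 = offset 1 \<and> R 11 = 1)"

definition potential :: "store \<Rightarrow> nat" where
  "potential s = remaining (snd s 2) (snd s 4)"

text \<open>The longest path has the outer test, six instructions, the inner test and two moves,
  hence 10 steps.\<close>

lemma halts_within_decide: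
  assumes ex: "explored (R 0) (R 1) (R 2) (R 3) (R 4) (R 5)" and less: "R 2 < slope 1"
    and g: "g = (R 5 - R 3) / (R 4 - R 2)"
    and R: "R 6 = slope 1" "R 7 = offset 1" "R 11 = 1" "R 8 = g" "R 9 = slope g" "R 10 = offset g"
      "R 12 = g * R 2 - R 3" "R 13 = g * slope g - offset g"
  shows "halts_within n f c decide (load [n], R) 10
    (\<lambda>s'. loop_inv s' \<and> potential s' < remaining (R 2) (R 4))"
proof -
  note adv = explored_advance[OF ex less g] and ref = explored_refine[OF ex less g]
  have g01: "g \<in> {0..1}" using explored_crossing[OF ex less] by (simp add: g)
  show ?thesis
  proof (cases "g * slope g - offset g \<le> g * R 2 - R 3")
    case True
    note a = adv[OF True]
    note rem = remaining_advance[OF g01 a(3)]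
    have "halts_within n f c
        (Branch (RLess (Dir 1) (Dir 12)) (block [RMove (Dir 1) (Dir 12), RMove (Dir 0) (Dir 8)]) (block []))
        (load [n], R(2 := slope g, 3 := offset g, 4 := slope 1, 5 := offset 1, 12 := payoff g)) 3
        (\<lambda>s'. loop_inv s' \<and> potential s' < remaining (R 2) (R 4))"
      by (rule halts_within_Branch, cases "R 1 < payoff g")
        (use a(1,2) rem in \<open>auto intro!: halts_within_block simp: loop_inv_def potential_def R\<close>)
    then have "halts_within n f c advance (load [n], R) 9
        (\<lambda>s'. loop_inv s' \<and> potential s' < remaining (R 2) (R 4))"
      unfolding advance_def by (intro halts_within_block_Seq) (simp_all add: R payoff_def fun_upd_twist)
    then show ?thesis
      unfolding decide_def by (intro halts_within_Branch) (simp_all add: R True)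
  next
    case False
    note r = ref[OF False]
    note rem = remaining_refine[OF g01 r(2)]
    have "halts_within n f c (block [RMove (Dir 4) (Dir 9), RMove (Dir 5) (Dir 10)]) (load [n], R) 9
        (\<lambda>s'. loop_inv s' \<and> potential s' < remaining (R 2) (R 4))"
      by (rule halts_within_block) (use r(1) rem in \<open>auto simp: loop_inv_def potential_def R\<close>)
    then show ?thesis
      unfolding decide_def by (intro halts_within_Branch) (simp_all add: R False)
  qed
qed

text \<open>Three steps compute the crossing, \<open>n + 6 + B\<close> the query, four the
  utilities, and ten decide.\<close>

lemma halts_within_round:
  assumes "loop_inv s" "holds (RLess (Dir 2) (Dir 6)) s"
  shows "halts_within n f c (round_prog D) s (n + B + 23)
    (\<lambda>s'. loop_inv s' \<and> potential s' < potential s)"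
proof -
  obtain R where s: "s = (load [n], R)" and ex: "explored (R 0) (R 1) (R 2) (R 3) (R 4) (R 5)"
    and R: "R 6 = slope 1" "R 7 = offset 1" "R 11 = 1"
    using assms(1) by (auto simp: loop_inv_def)
  have less: "R 2 < slope 1" using assms(2) R by (simp add: s)
  define g where "g = (R 5 - R 3) / (R 4 - R 2)"
  have g01: "g \<in> {0..1}" using explored_crossing[OF ex less] by (simp add: g_def)
  define R1 where "R1 = R(12 := R 5 - R 3, 13 := R 4 - R 2, 8 := g)"
  have R1: "R1 8 = g" "\<And>i. i < 8 \<Longrightarrow> R1 i = R i" "R1 11 = R 11" by (auto simp: R1_def)
  have rest: "halts_within n f c
      (Seq (block [ROp RMul (Dir 12) (Dir 8) (Dir 2), ROp RSub (Dir 12) (Dir 12) (Dir 3),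
              ROp RMul (Dir 13) (Dir 8) (Dir 9), ROp RSub (Dir 13) (Dir 13) (Dir 10)])
         decide) s' 14 (\<lambda>s'. loop_inv s' \<and> potential s' < potential s)"
    if got: "\<exists>R'. s' = (load [n], R') \<and> R' 9 = slope (R1 8) \<and> R' 10 = offset (R1 8) \<and>
      (\<forall>i < 14. i \<noteq> 9 \<longrightarrow> i \<noteq> 10 \<longrightarrow> R' i = R1 i)" for s'
  proof -
    obtain R' where s': "s' = (load [n], R')" and q: "R' 9 = slope g" "R' 10 = offset g"
      and same: "\<And>i. i < 14 \<Longrightarrow> i \<noteq> 9 \<Longrightarrow> i \<noteq> 10 \<Longrightarrow> R' i = R1 i"
      using got R1(1) by auto
    define R2 where "R2 = R'(12 := g * R' 2 - R' 3, 13 := g * R' 9 - R' 10)"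
    have R2: "R2 i = R i" if "i < 8" for i using that same[of i] R1(2)[of i] by (simp add: R2_def)
    have R2': "R2 6 = slope 1" "R2 7 = offset 1" "R2 11 = 1" "R2 8 = g" "R2 9 = slope g"
      "R2 10 = offset g" "R2 12 = g * R2 2 - R2 3" "R2 13 = g * slope g - offset g"
      using R2 R R1 same q by (simp_all add: R2_def)
    have "halts_within n f c decide (load [n], R2) 10
        (\<lambda>s'. loop_inv s' \<and> potential s' < remaining (R2 2) (R2 4))"
      by (rule halts_within_decide[where g = g]) (use ex less R2 R2' in \<open>simp_all add: g_def\<close>)
    then show ?thesis
      using R2 same R1 unfolding s'
      by (intro halts_within_block_Seq) (simp_all add: R2_def potential_def s fun_upd_twist)
  qed
  have "halts_within n f c (round_prog D) s (3 + ((n + 6 + B) + 14))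
      (\<lambda>s'. loop_inv s' \<and> potential s' < potential s)"
    unfolding round_prog_def
  proof (rule halts_within_block_Seq)
    show "halts_within n f c (Seq (consult D)
       (Seq (block [ROp RMul (Dir 12) (Dir 8) (Dir 2), ROp RSub (Dir 12) (Dir 12) (Dir 3),
              ROp RMul (Dir 13) (Dir 8) (Dir 9), ROp RSub (Dir 13) (Dir 13) (Dir 10)])
         decide)) (fold (step n f c) [ROp RSub (Dir 12) (Dir 5) (Dir 3), ROp RSub (Dir 13) (Dir 4) (Dir 2),
        ROp RDiv (Dir 8) (Dir 12) (Dir 13)] s) (3 + (n + 6 + B + 14) - length [ROp RSub (Dir 12) (Dir 5) (Dir 3),
          ROp RSub (Dir 13) (Dir 4) (Dir 2), ROp RDiv (Dir 8) (Dir 12) (Dir 13)])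
       (\<lambda>s'. loop_inv s' \<and> potential s' < potential s)"
      using halts_within_Seq[OF halts_within_consult rest, of R1] g01 R1(1)
      by (simp add: s R1_def g_def)
  qed simp
  then show ?thesis by (simp add: add_ac)
qed

lemma halts_within_init:
  "halts_within n f c (init_prog D) (load [n], load []) (2 * (n + B) + 23) loop_inv"
proof -
  define R1 :: "nat \<Rightarrow> real" where "R1 = (load [])(11 := 1, 8 := 0)"
  let ?mid = "[RConst (Dir 0) 0, RMove (Dir 1) (Dir 9), RMove (Dir 2) (Dir 9), RMove (Dir 3) (Dir 10),
              RMove (Dir 8) (Dir 11)]"
  let ?fin = "[RMove (Dir 4) (Dir 9), RMove (Dir 5) (Dir 10), RMove (Dir 6) (Dir 9), RMove (Dir 7) (Dir 10)]"
  let ?got = "\<lambda>R s'. \<exists>R'. s' = (load [n], R') \<and> R' 9 = slope (R 8) \<and> R' 10 = offset (R 8) \<and>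
      (\<forall>i < 14. i \<noteq> 9 \<longrightarrow> i \<noteq> 10 \<longrightarrow> R' i = R i)"
  have rest: "halts_within n f c (Seq (block ?mid) (Seq (consult D) (block ?fin))) s'
      (5 + ((n + 6 + B) + 4)) loop_inv" if got: "?got R1 s'" for s'
  proof -
    obtain R' where s': "s' = (load [n], R')" and q: "R' 9 = slope 0" "R' 10 = offset 0"
      and one: "R' 11 = 1"
      using got by (auto simp: R1_def)
    define R2 where "R2 = R'(0 := 0, 1 := slope 0, 2 := slope 0, 3 := offset 0, 8 := 1)"
    have "halts_within n f c (block ?fin) s'' 4 loop_inv" if "?got R2 s''" for s''
      by (rule halts_within_block)
        (use that one explored_initially in \<open>auto simp: R2_def loop_inv_def\<close>)
    then have "halts_within n f c (Seq (consult D) (block ?fin)) (load [n], R2) ((n + 6 + B) + 4) loop_inv"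
      by (intro halts_within_Seq[OF halts_within_consult]) (auto simp: R2_def)
    then show ?thesis
      using one q unfolding s' by (intro halts_within_block_Seq) (simp_all add: R2_def)
  qed
  have "halts_within n f c (init_prog D) (load [n], load []) (2 + ((n + 6 + B) + (5 + ((n + 6 + B) + 4)))) loop_inv"
    unfolding init_prog_def
    using halts_within_Seq[OF halts_within_consult rest, of R1]
    by (intro halts_within_block_Seq) (simp_all add: R1_def add_ac)
  then show ?thesis by (simp add: algebra_simps)
qed

text \<open>\<open>K * (K + 1) + K\<close> bounds the potential and thereby the number of rounds;
  \<open>n + B + 24\<close> pays for one round and its test.\<close>

lemma halts_within_contract_prog:
  assumes "card (slope ` {0..1}) \<le> K"
  shows "halts_within n f c (contract_prog D) (load [n], load [])
    (2 * (n + B) + 23 + ((K * (K + 1) + K) * (n + B + 24) + 1))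
    (\<lambda>(N, R). R 0 \<in> {0..1} \<and> (\<forall>x\<in>{0..1}. payoff x \<le> payoff (R 0)))"
  unfolding contract_prog_def
proof (rule halts_within_Seq[OF halts_within_init])
  fix s assume s: "loop_inv s"
  have "card (slope ` {0..1}) * (card (slope ` {0..1}) + 1) + card (slope ` {0..1}) \<le> K * (K + 1) + K"
    using assms by (intro add_mono mult_le_mono) auto
  then have "potential s \<le> K * (K + 1) + K"
    unfolding potential_def using remaining_le order_trans by blast
  then have "potential s * (n + B + 24) \<le> (K * (K + 1) + K) * (n + B + 24)"
    by (rule mult_le_mono1)
  moreover have "n + B + 23 + 1 = n + B + 24" by simp
  ultimately have le: "potential s * (n + B + 23 + 1) + 1 \<le> (K * (K + 1) + K) * (n + B + 24) + 1"
    by (simp only: add_le_cancel_right)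
  show "halts_within n f c (While (RLess (Dir 2) (Dir 6)) (round_prog D)) s
      ((K * (K + 1) + K) * (n + B + 24) + 1)
      (\<lambda>(N, R). R 0 \<in> {0..1} \<and> (\<forall>x\<in>{0..1}. payoff x \<le> payoff (R 0)))"
    by (rule halts_within_mono[OF halts_within_While[OF halts_within_round s] le])
      (use explored_finished in \<open>fastforce simp: loop_inv_def\<close>)+
qed

end

theorem proposition1:
  fixes \<J> :: "setting set"
  assumes "\<And>J. J \<in> \<J> \<Longrightarrow> valid_setting J"
    and "poly_many_critical_values \<J>"
    and "\<exists>D. poly_time_demand \<J> D"
  shows "\<exists>P. poly_time_optimal_contract \<J> P"
proof -
  obtain D q where q: "\<And>J \<alpha>. J \<in> \<J> \<Longrightarrow> \<alpha> \<in> {0..1} \<Longrightarrow> \<exists>t N R.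
     exec (size_of J) (reward J) (cost J) D (load [size_of J], load [\<alpha>]) t (N, R) \<and>
     t \<le> poly q (size_of J) \<and> set_at (size_of J) R 0 = demand J \<alpha>"
    using assms(3) unfolding poly_time_demand_def by metis
  obtain r where r: "\<And>J. J \<in> \<J> \<Longrightarrow> card (critical_values J) \<le> poly r (size_of J)"
    using assms(2) unfolding poly_many_critical_values_def by metis
  \<comment> \<open>The step bound with \<open>q\<close> for \<open>B\<close> and \<open>r\<close>
    for \<open>K\<close>: \<open>[:23, 2:]\<close> is 2n + 23 and \<open>[:24, 1:]\<close> is n +
    24.\<close>
  define w where "w = [:23, 2:] + 2 * q + ((r * (r + 1) + r) * ([:24, 1:] + q) + 1)"
  have "poly_time_optimal_contract \<J> (contract_prog D)"
    unfolding poly_time_optimal_contract_def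
  proof (intro exI[of _ w] ballI)
    fix J assume J: "J \<in> \<J>"
    let ?n = "size_of J" and ?s = "\<lambda>x. reward J (demand J x)"
    interpret envelope ?s "\<lambda>x. cost J (demand J x)"
      by (rule envelope_demand[OF assms(1)[OF J]])
    interpret contract_run ?s "\<lambda>x. cost J (demand J x)" ?n "reward J" "cost J" D "poly q ?n"
      by unfold_locales (use q[OF J] in metis)
    have "card (?s ` {0..1}) \<le> poly r ?n"
      using card_demand_rewards[OF assms(1)[OF J]] r[OF J] by (rule order_trans)
    from halts_within_contract_prog[OF this] obtain t N R where
      e: "exec ?n (reward J) (cost J) (contract_prog D) (load [?n], load []) t (N, R)"
      and t: "t \<le> 2 * (?n + poly q ?n) + 23 +
        ((poly r ?n * (poly r ?n + 1) + poly r ?n) * (?n + poly q ?n + 24) + 1)"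
      and opt: "R 0 \<in> {0..1}" "\<forall>x\<in>{0..1}. payoff x \<le> payoff (R 0)"
      by (auto simp: halts_within_def)
    have "t \<le> poly w ?n" using t by (simp add: w_def algebra_simps)
    moreover have "optimal_contract J (R 0)"
      using opt by (simp add: optimal_contract_def principal_utility_def payoff_def)
    ultimately show "\<exists>t N R. exec ?n (reward J) (cost J) (contract_prog D) (load [?n], load []) t (N, R) \<and>
        t \<le> poly w ?n \<and> optimal_contract J (R 0)"
      using e by blast
  qed
  then show ?thesis by blast
qed

end
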